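(* Every thin Blaschke product $B$ is a branched covering map $B:\mathbb{D}\to\mathbb{D}$.
   Context: $\mathbb{D}$ is the open unit disk. A thin Blaschke product is an infinite Blaschke product $B$ whose zero sequence $\{z_n\}$ satisfies $\lim_{k\to\infty}\prod_{j\ne k} d(z_j,z_k)=1$, where $d(z,\lambda)=\left|\frac{\lambda-z}{1-\overline{\lambda}z}\right|$ is the pseudohyperbolic distance. A thin Blaschke product has image exactly $\mathbb{D}$. A holomorphic map $\phi:\mathbb{D}\to\Omega$ is called a branched covering map if every point of $\Omega$ has a connected open neighborhood $U$ such that each connected component $V$ of $\phi^{-1}(U)$ maps onto $U$ by a proper map $\phi|_V:V\to U$ (proper: preimages of compact sets are compact). *)

theory Defs
  imports "HOL-Complex_Analysis.Complex_Analysis"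
begin

definition pseudohyperbolic_dist :: "complex \<Rightarrow> complex \<Rightarrow> real" where
  "pseudohyperbolic_dist z l = cmod ((l - z) / (1 - cnj l * z))"

definition blaschke_factor :: "complex \<Rightarrow> complex \<Rightarrow> complex" where
  "blaschke_factor a z =
     (if a = 0 then z else (of_real (cmod a) / a) * ((a - z) / (1 - cnj a * z)))"

text \<open>
  The zero sequence lists zeros with multiplicity; summability is the Blaschke condition,
  which makes the product below converge on the unit disk. The library's \<^const>\<open>prodinf\<close>
  has value 0, as it should, when finitely many factors vanish and the remaining
  product converges.
\<close>

definition blaschke_sequence :: "(nat \<Rightarrow> complex) \<Rightarrow> bool" where
  "blaschke_sequence a \<longleftrightarrow> (\<forall>n. a n \<in> ball 0 1) \<and> summable (\<lambda>n. 1 - cmod (a n))"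

definition thin_sequence :: "(nat \<Rightarrow> complex) \<Rightarrow> bool" where
  "thin_sequence a \<longleftrightarrow>
     (\<lambda>k. \<Prod>j. if j = k then 1 else pseudohyperbolic_dist (a j) (a k)) \<longlonglongrightarrow> 1"

text \<open>The values of \<open>B\<close> outside the unit disk are irrelevant.\<close>

definition infinite_blaschke_product_with_zeros ::
    "(complex \<Rightarrow> complex) \<Rightarrow> (nat \<Rightarrow> complex) \<Rightarrow> bool" where
  "infinite_blaschke_product_with_zeros B a \<longleftrightarrow>
     blaschke_sequence a \<and>
     (\<exists>u. cmod u = 1 \<and> (\<forall>z\<in>ball 0 1. B z = u * (\<Prod>n. blaschke_factor (a n) z)))"

definition thin_blaschke_product :: "(complex \<Rightarrow> complex) \<Rightarrow> bool" where
  "thin_blaschke_product B \<longleftrightarrow>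
     (\<exists>a. infinite_blaschke_product_with_zeros B a \<and> thin_sequence a)"

text \<open>
  Here \<open>\<Omega>\<close> is an open subset of the plane, so neighbourhoods may be taken open in the plane.
\<close>

definition branched_covering_map :: "(complex \<Rightarrow> complex) \<Rightarrow> complex set \<Rightarrow> bool" where
  "branched_covering_map \<phi> \<Omega> \<longleftrightarrow>
     \<phi> holomorphic_on ball 0 1 \<and> \<phi> ` ball 0 1 \<subseteq> \<Omega> \<and>
     (\<forall>w\<in>\<Omega>. \<exists>U. open U \<and> connected U \<and> w \<in> U \<and> U \<subseteq> \<Omega> \<and>
        (\<forall>V\<in>components (ball 0 1 \<inter> \<phi> -` U).
           \<phi> ` V = U \<and>
           (\<forall>K. K \<subseteq> U \<and> compact K \<longrightarrow> compact (V \<inter> \<phi> -` K))))"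

end

theory Submission imports Defs begin

text \<open>
  For \<open>w\<close> in the disk take \<open>U = ball 0 r\<close> with \<open>\<bar>w\<bar> < r < 1\<close>. Everything rests on one fact:
  each component \<open>V\<close> of \<open>{\<bar>B\<bar> < r}\<close> stays away from the unit circle
  (\<open>thin_blaschke_sublevel_connected_bounded\<close>). Once this is known, \<open>B\<close> is proper on \<open>V\<close>, because
  \<open>V\<close> is relatively closed in the preimage of \<open>U\<close> and cannot lose points at the boundary of the
  disk; its image is then open in \<open>U\<close> by the open mapping theorem and closed in \<open>U\<close> by
  properness, hence all of \<open>U\<close> (\<open>proper_surjective_on_relatively_compact_component\<close>).

  To confine \<open>V\<close>, fix \<open>\<rho> < \<eta> < 1\<close> with \<open>r \<le> \<rho>\<^sup>2\<close> and split \<open>B\<close> into the product of its first \<open>N\<close>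
  factors and a tail. The finite product has modulus at least \<open>\<rho>\<close> near the unit circle, since it is
  continuous on the closed disk and has modulus 1 on the circle. For the tail, let \<open>\<delta> < 1\<close> be such that
  \<open>\<eta> (\<delta> - \<eta>) / (1 - \<eta> \<delta>) = \<rho>\<close>; thinness gives \<open>N\<close> so that, for \<open>n \<ge> N\<close>, the product over the other
  tail zeros has modulus at least \<open>\<delta>\<close> at \<open>a n\<close>. The Schwarz-Pick lemma spreads this to the circle
  of pseudohyperbolic radius \<open>\<eta>\<close> around \<open>a n\<close>, where the tail therefore has modulus at least \<open>\<rho>\<close>, as
  in Hoffman's lemma on interpolating sequences. The minimum modulus principle carries the bound to
  all points outside the pseudohyperbolic discs bounded by these circles. Boundary values of
  infinite products are avoided by proving the tail bound for finite partial products, uniformly in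
  their length, and passing to the limit.

  So near the unit circle \<open>{\<bar>B\<bar> < r}\<close> lies in the discs and misses their boundaries. If \<open>V\<close> meets a
  disc that is close enough to the unit circle, then by connectedness it lies inside that disc;
  otherwise it lies in a smaller concentric disk together with finitely many discs. In both cases \<open>V\<close>
  stays away from the unit circle.
\<close>

section \<open>Pseudohyperbolic distance\<close>

lemma one_minus_cnj_mult_nonzero:
  assumes "cmod a < 1" "cmod z \<le> 1"
  shows "1 - cnj a * z \<noteq> 0"
proof
  assume "1 - cnj a * z = 0"
  then have "cmod (cnj a * z) = 1" by simp
  moreover have "cmod a * cmod z \<le> cmod a * 1"
    using assms by (intro mult_left_mono) auto
  ultimately show False using assms by (simp add: norm_mult)
qed

lemma pseudohyperbolic_dist_commute: "pseudohyperbolic_dist z l = pseudohyperbolic_dist l z"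
proof -
  have "cmod (1 - cnj l * z) = cmod (cnj (1 - cnj l * z))" by (rule complex_mod_cnj[symmetric])
  also have "\<dots> = cmod (1 - cnj z * l)" by (simp add: mult.commute)
  finally show ?thesis
    by (simp add: pseudohyperbolic_dist_def norm_divide norm_minus_commute)
qed

lemma norm_blaschke_factor: "cmod (blaschke_factor a z) = pseudohyperbolic_dist z a"
  by (simp add: blaschke_factor_def pseudohyperbolic_dist_def norm_divide norm_mult)

text \<open>
  From \<open>\<bar>1 - cnj a z\<bar>\<^sup>2 - \<bar>a - z\<bar>\<^sup>2 = (1 - \<bar>a\<bar>\<^sup>2) (1 - \<bar>z\<bar>\<^sup>2)\<close>. All size estimates for the distance come
  from this identity.
\<close>

lemma pseudohyperbolic_dist_sq:
  assumes "cmod a < 1" "cmod z \<le> 1"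
  shows "1 - (pseudohyperbolic_dist z a)\<^sup>2
           = (1 - (cmod a)\<^sup>2) * (1 - (cmod z)\<^sup>2) / (cmod (1 - cnj a * z))\<^sup>2"
proof -
  have nz: "cmod (1 - cnj a * z) \<noteq> 0" using one_minus_cnj_mult_nonzero[OF assms] by simp
  have "(cmod (1 - cnj a * z))\<^sup>2 - (cmod (a - z))\<^sup>2 = (1 - (cmod a)\<^sup>2) * (1 - (cmod z)\<^sup>2)"
    unfolding cmod_power2 by (simp add: algebra_simps power2_eq_square)
  then show ?thesis using nz
    by (simp add: pseudohyperbolic_dist_def norm_divide power_divide divide_simps)
qed

lemma pseudohyperbolic_dist_nonneg: "pseudohyperbolic_dist z a \<ge> 0"
  by (simp add: pseudohyperbolic_dist_def)

lemma pseudohyperbolic_dist_less_1: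
  assumes "cmod a < 1" "cmod z < 1"
  shows "pseudohyperbolic_dist z a < 1"
proof -
  have "0 < (1 - (cmod a)\<^sup>2) * (1 - (cmod z)\<^sup>2) / (cmod (1 - cnj a * z))\<^sup>2"
    using assms one_minus_cnj_mult_nonzero[of a z]
    by (intro divide_pos_pos mult_pos_pos) (auto simp: power_less_one_iff abs_square_less_1)
  then have "(pseudohyperbolic_dist z a)\<^sup>2 < 1"
    using pseudohyperbolic_dist_sq[of a z] assms by simp
  then show ?thesis using pseudohyperbolic_dist_nonneg[of z a] by (simp add: abs_square_less_1)
qed

lemma pseudohyperbolic_dist_eq_1:
  assumes "cmod a < 1" "cmod z = 1"
  shows "pseudohyperbolic_dist z a = 1"
proof -
  have "(pseudohyperbolic_dist z a)\<^sup>2 = 1"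
    using pseudohyperbolic_dist_sq[of a z] assms by simp
  then show ?thesis using pseudohyperbolic_dist_nonneg[of z a] by (simp add: power2_eq_1_iff)
qed

text \<open>
  Rotating \<open>a\<close> and \<open>z\<close> onto the same radius can only decrease their distance: in the identity
  \<open>pseudohyperbolic_dist_sq\<close> the denominator is at least \<open>(1 - \<bar>a\<bar> \<bar>z\<bar>)\<^sup>2\<close>.
\<close>

lemma norm_diff_le_pseudohyperbolic_dist:
  assumes "cmod a < 1" "cmod z < 1"
  shows "cmod a - cmod z \<le> pseudohyperbolic_dist z a * (1 - cmod a * cmod z)"
proof -
  define x y d where "x = cmod a" "y = cmod z" "d = pseudohyperbolic_dist z a"
  have xy: "0 \<le> x" "x < 1" "0 \<le> y" "y < 1" "0 \<le> d" "d < 1"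
    using assms pseudohyperbolic_dist_less_1 pseudohyperbolic_dist_nonneg by (auto simp: x_y_d_def)
  have pos: "1 - x * y > 0"
    using mult_strict_mono[of x 1 y 1] xy by simp
  have "1 - x * y \<le> cmod (1 - cnj a * z)"
    using norm_triangle_ineq2[of 1 "cnj a * z"] by (simp add: x_y_d_def norm_mult)
  then have "(1 - x * y)\<^sup>2 \<le> (cmod (1 - cnj a * z))\<^sup>2"
    using pos by (intro power_mono) auto
  moreover have "0 \<le> (1 - x\<^sup>2) * (1 - y\<^sup>2)"
    using xy by (intro mult_nonneg_nonneg) (auto simp: power_le_one)
  ultimately have "(1 - x\<^sup>2) * (1 - y\<^sup>2) / (cmod (1 - cnj a * z))\<^sup>2
      \<le> (1 - x\<^sup>2) * (1 - y\<^sup>2) / (1 - x * y)\<^sup>2"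
    using pos one_minus_cnj_mult_nonzero[of a z] assms
    by (intro divide_left_mono mult_pos_pos) auto
  then have "1 - d\<^sup>2 \<le> (1 - x\<^sup>2) * (1 - y\<^sup>2) / (1 - x * y)\<^sup>2"
    using pseudohyperbolic_dist_sq[of a z] assms by (simp add: x_y_d_def)
  then have "(1 - d\<^sup>2) * (1 - x * y)\<^sup>2 \<le> (1 - x\<^sup>2) * (1 - y\<^sup>2)"
    using pos by (simp add: pos_le_divide_eq)
  then have "(x - y)\<^sup>2 \<le> (d * (1 - x * y))\<^sup>2"
    by (simp add: power2_eq_square algebra_simps)
  then have "x - y \<le> d * (1 - x * y)"
    by (rule power2_le_imp_le) (use pos xy in auto)
  then show ?thesis by (simp add: x_y_d_def)
qed

text \<open>
  The bound on the right is the point at distance \<open>\<eta>\<close> beyond \<open>s\<close> on the positive radius. It shows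
  that discs of fixed radius \<open>\<eta>\<close> meeting a smaller concentric disk have centers in a compact subset
  of the unit disk and, with the two points exchanged, that each single disc is relatively compact.
\<close>

lemma norm_le_of_pseudohyperbolic_dist_le:
  assumes "cmod a < 1" "cmod z < 1" "pseudohyperbolic_dist z a \<le> \<eta>" "cmod z \<le> s" "\<eta> < 1"
  shows "cmod a \<le> (\<eta> + s) / (1 + \<eta> * s)"
proof -
  define x y where "x = cmod a" "y = cmod z"
  have xy: "0 \<le> x" "x < 1" "0 \<le> y" "y < 1" "0 \<le> \<eta>" "y \<le> s"
    using assms pseudohyperbolic_dist_nonneg[of z a] by (auto simp: x_y_def)
  have pos: "1 - x * y > 0"
    using mult_strict_mono[of x 1 y 1] xy by simp
  have "x - y \<le> pseudohyperbolic_dist z a * (1 - x * y)"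
    using norm_diff_le_pseudohyperbolic_dist[OF assms(1,2)] by (simp add: x_y_def)
  also have "\<dots> \<le> \<eta> * (1 - x * y)"
    using assms(3) pos by (intro mult_right_mono) auto
  finally have "x - y \<le> \<eta> * (1 - x * y)" .
  then have "x \<le> \<eta> + y * (1 - \<eta> * x)" by (simp add: algebra_simps)
  also have "\<dots> \<le> \<eta> + s * (1 - \<eta> * x)"
    using xy assms(5) mult_mono[of \<eta> 1 x 1] by (intro add_left_mono mult_right_mono) auto
  finally have "x * (1 + \<eta> * s) \<le> \<eta> + s" by (simp add: algebra_simps)
  moreover have "1 + \<eta> * s > 0"
    using mult_nonneg_nonneg[of \<eta> s] xy by linarith
  ultimately show ?thesis by (simp add: pos_le_divide_eq x_y_def)
qed

lemma pseudohyperbolic_sum_less_1: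
  fixes \<eta> s :: real
  assumes "0 \<le> \<eta>" "\<eta> < 1" "0 \<le> s" "s < 1"
  shows "(\<eta> + s) / (1 + \<eta> * s) < 1"
proof -
  have "0 < (1 - \<eta>) * (1 - s)" using assms by simp
  then have "\<eta> + s < 1 + \<eta> * s" by (simp add: algebra_simps)
  moreover have "1 + \<eta> * s > 0"
    using mult_nonneg_nonneg[of \<eta> s] assms by linarith
  ultimately show ?thesis by simp
qed

section \<open>Schwarz-Pick\<close>

text \<open>
  Moebius transformations moving \<open>p\<close> and \<open>g p\<close> to the origin reduce this to the Schwarz lemma.
\<close>

lemma Schwarz_Pick:
  assumes "g holomorphic_on ball 0 1" "\<And>z. cmod z < 1 \<Longrightarrow> cmod (g z) < 1"
    and "cmod p < 1" "cmod z < 1"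
  shows "pseudohyperbolic_dist (g z) (g p) \<le> pseudohyperbolic_dist z p"
proof -
  define F where "F = Moebius_function 0 (g p) \<circ> (g \<circ> Moebius_function 0 (-p))"
  have norm_M: "cmod (Moebius_function 0 a x) = pseudohyperbolic_dist x a" for a x
    by (simp add: Moebius_function_simple pseudohyperbolic_dist_def norm_divide norm_minus_commute)
  have into: "cmod (Moebius_function 0 (-p) x) < 1" if "cmod x < 1" for x
    using Moebius_function_norm_lt_1 that assms(3) by simp
  have "F holomorphic_on ball 0 1"
    unfolding F_def using assms into
    by (intro holomorphic_on_compose_gen[where t = "ball 0 1"] Moebius_function_holomorphic) auto
  moreover have "F 0 = 0"
    by (simp add: F_def Moebius_function_of_zero Moebius_function_eq_zero)
  moreover have "cmod (F x) < 1" if "cmod x < 1" for x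
    unfolding F_def using Moebius_function_norm_lt_1 into assms that by simp
  moreover have "cmod (Moebius_function 0 p z) < 1"
    using Moebius_function_norm_lt_1 assms by simp
  ultimately have "cmod (F (Moebius_function 0 p z)) \<le> cmod (Moebius_function 0 p z)"
    by (rule Schwarz_Lemma(1))
  moreover have "Moebius_function 0 (-p) (Moebius_function 0 p z) = z"
    using Moebius_function_compose[of "-p" p z] assms by simp
  ultimately show ?thesis by (simp add: F_def norm_M)
qed

text \<open>
  The value \<open>g z\<close> lies within distance \<open>\<eta>\<close> of \<open>g p\<close>, so its modulus cannot drop
  below \<open>(\<delta> - \<eta>) / (1 - \<eta> \<delta>)\<close>, the radial point at distance \<open>\<eta>\<close> from \<open>\<delta>\<close>.
\<close>

lemma norm_ge_of_Schwarz_Pick: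
  assumes "g holomorphic_on ball 0 1" "\<And>z. cmod z < 1 \<Longrightarrow> cmod (g z) < 1"
    and "cmod p < 1" "cmod z < 1" "pseudohyperbolic_dist z p \<le> \<eta>" "\<eta> < 1"
    and "\<delta> \<le> cmod (g p)"
  shows "\<delta> - \<eta> \<le> (1 - \<eta> * \<delta>) * cmod (g z)"
proof -
  define x y where "x = cmod (g p)" "y = cmod (g z)"
  have xy: "0 \<le> x" "x < 1" "0 \<le> y" "y < 1" "0 \<le> \<eta>"
    using assms pseudohyperbolic_dist_nonneg[of z p] by (auto simp: x_y_def)
  have pos: "1 - x * y > 0"
    using mult_strict_mono[of x 1 y 1] xy by simp
  have "pseudohyperbolic_dist (g z) (g p) \<le> \<eta>"
    using Schwarz_Pick[OF assms(1,2,3,4)] assms(5) by simp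
  then have "pseudohyperbolic_dist (g z) (g p) * (1 - x * y) \<le> \<eta> * (1 - x * y)"
    using pos by (intro mult_right_mono) auto
  moreover have "x - y \<le> pseudohyperbolic_dist (g z) (g p) * (1 - x * y)"
    using norm_diff_le_pseudohyperbolic_dist[of "g p" "g z"] assms(2,3,4) by (simp add: x_y_def)
  ultimately have "x - y \<le> \<eta> * (1 - x * y)" by linarith
  then have "x * (1 + \<eta> * y) \<le> \<eta> + y" by (simp add: algebra_simps)
  moreover have "\<delta> * (1 + \<eta> * y) \<le> x * (1 + \<eta> * y)"
    using xy assms by (intro mult_right_mono) (auto simp: x_y_def)
  ultimately show ?thesis by (simp add: algebra_simps x_y_def)
qed

section \<open>Finite Blaschke products\<close>

lemma blaschke_factor_holomorphic:
  assumes "cmod a < 1"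
  shows "blaschke_factor a holomorphic_on ball 0 1"
proof -
  have "1 - cnj a * z \<noteq> 0" if "z \<in> ball 0 1" for z
    using one_minus_cnj_mult_nonzero[of a z] that assms by auto
  then show ?thesis
    unfolding blaschke_factor_def [abs_def]
    by (cases "a = 0") (auto intro!: holomorphic_intros)
qed

lemma blaschke_factor_continuous:
  assumes "cmod a < 1"
  shows "continuous_on (cball 0 1) (blaschke_factor a)"
proof -
  have "1 - cnj a * z \<noteq> 0" if "z \<in> cball 0 1" for z
    using one_minus_cnj_mult_nonzero[of a z] that assms by auto
  then show ?thesis
    unfolding blaschke_factor_def [abs_def]
    by (cases "a = 0") (auto intro!: continuous_intros)
qed

lemma pseudohyperbolic_dist_continuous:
  assumes "cmod a < 1"
  shows "continuous_on (cball 0 1) (\<lambda>z. pseudohyperbolic_dist z a)"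
  using continuous_on_norm[OF blaschke_factor_continuous[OF assms]]
  by (simp add: norm_blaschke_factor)

text \<open>
  On the closed disk with the open discs around the zeros removed, the reciprocal of the product is
  holomorphic inside and continuous up to the boundary, and a boundary point lies on the unit circle,
  where the product has modulus 1, or on one of the given circles. The discs may overlap: the bound
  is assumed on the whole of each circle.
\<close>

lemma finite_blaschke_product_minimum_modulus:
  assumes J: "finite J" "\<And>j. j \<in> J \<Longrightarrow> cmod (a j) < 1"
    and \<rho>: "0 < \<rho>" "\<rho> \<le> 1" and \<eta>: "0 < \<eta>"
    and circles: "\<And>n z. n \<in> J \<Longrightarrow> cmod z < 1 \<Longrightarrow> pseudohyperbolic_dist z (a n) = \<eta> \<Longrightarrow>
       \<rho> \<le> (\<Prod>j\<in>J. pseudohyperbolic_dist z (a j))"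
    and z: "cmod z < 1" "\<And>n. n \<in> J \<Longrightarrow> \<eta> \<le> pseudohyperbolic_dist z (a n)"
  shows "\<rho> \<le> (\<Prod>j\<in>J. pseudohyperbolic_dist z (a j))"
proof -
  define f where "f x = inverse (\<Prod>j\<in>J. blaschke_factor (a j) x)" for x
  define S where "S = cball 0 1 \<inter> (\<Inter>n\<in>J. {x \<in> cball 0 1. \<eta> \<le> pseudohyperbolic_dist x (a n)})"
  have norm_f: "cmod (f x) = inverse (\<Prod>j\<in>J. pseudohyperbolic_dist x (a j))" for x
    by (simp add: f_def norm_inverse prod_norm[symmetric] norm_blaschke_factor)
  have nz: "(\<Prod>j\<in>J. blaschke_factor (a j) x) \<noteq> 0" if "x \<in> S" for x
  proof -
    have "blaschke_factor (a j) x \<noteq> 0" if "j \<in> J" for j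
    proof -
      have "cmod (blaschke_factor (a j) x) > 0"
        using \<open>x \<in> S\<close> that \<eta> by (auto simp: S_def norm_blaschke_factor intro: less_le_trans)
      then show ?thesis by simp
    qed
    then show ?thesis using J by simp
  qed
  have "closed {x \<in> cball 0 1. \<eta> \<le> pseudohyperbolic_dist x (a n)}" if "n \<in> J" for n
    using continuous_on_closed_Collect_le[OF continuous_on_const
        pseudohyperbolic_dist_continuous[OF J(2)[OF that]] closed_cball] .
  then have S: "closed S" unfolding S_def by auto
  have "interior S \<subseteq> interior (cball 0 1)" by (intro interior_mono) (auto simp: S_def)
  then have int: "interior S \<subseteq> ball 0 1" "interior S \<subseteq> S" by (auto simp: interior_subset)
  have "cmod (f z) \<le> inverse \<rho>"
  proof (rule maximum_modulus_frontier[where f = f and S = S])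
    show "f holomorphic_on interior S"
      unfolding f_def[abs_def]
    proof (intro holomorphic_on_inverse holomorphic_on_prod)
      show "blaschke_factor (a j) holomorphic_on interior S" if "j \<in> J" for j
        using blaschke_factor_holomorphic[OF J(2)[OF that]] int(1) holomorphic_on_subset by blast
    qed (use int nz in auto)
    have "continuous_on S f"
      unfolding f_def[abs_def]
    proof (intro continuous_on_inverse continuous_on_prod)
      show "continuous_on S (blaschke_factor (a j))" if "j \<in> J" for j
        using blaschke_factor_continuous[OF J(2)[OF that]] continuous_on_subset
        unfolding S_def by blast
    qed (use nz in auto)
    then show "continuous_on (closure S) f" using S by simp
    show "bounded S" by (rule bounded_subset[of "cball 0 1"]) (auto simp: S_def)
    show "z \<in> S" using z by (auto simp: S_def)
    show "cmod (f x) \<le> inverse \<rho>" if "x \<in> frontier S" for x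
    proof -
      have xS: "x \<in> S" "x \<notin> interior S" using that S by (auto simp: frontier_def)
      have "\<rho> \<le> (\<Prod>j\<in>J. pseudohyperbolic_dist x (a j))"
      proof (cases "cmod x = 1")
        case True
        then show ?thesis using \<rho> J by (simp add: pseudohyperbolic_dist_eq_1)
      next
        case False
        then have x1: "cmod x < 1" using xS by (auto simp: S_def)
        have "\<exists>n\<in>J. pseudohyperbolic_dist x (a n) = \<eta>"
        proof (rule ccontr)
          assume "\<not> ?thesis"
          then have gt: "\<eta> < pseudohyperbolic_dist x (a n)" if "n \<in> J" for n
            using xS that by (force simp: S_def)
          define T where "T = ball 0 1 \<inter> (\<Inter>n\<in>J. {x \<in> ball 0 1. \<eta> < pseudohyperbolic_dist x (a n)})"
          have "open {x \<in> ball 0 1. \<eta> < pseudohyperbolic_dist x (a n)}" if "n \<in> J" for n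
          proof -
            have "continuous_on (ball 0 1) (\<lambda>x. pseudohyperbolic_dist x (a n))"
              using pseudohyperbolic_dist_continuous[OF J(2)[OF that]]
                continuous_on_subset ball_subset_cball by blast
            then have "open (ball 0 1 \<inter> (\<lambda>x. pseudohyperbolic_dist x (a n)) -` {\<eta><..})"
              by (intro continuous_open_preimage) auto
            then show ?thesis by (simp add: vimage_def Int_def)
          qed
          then have "open T" unfolding T_def using J by auto
          moreover have "T \<subseteq> S" by (auto simp: T_def S_def less_imp_le)
          moreover have "x \<in> T" using gt x1 by (auto simp: T_def)
          ultimately show False using xS(2) interiorI by blast
        qed
        then show ?thesis using circles x1 by blast
      qed
      then show ?thesis unfolding norm_f using \<rho> by (intro le_imp_inverse_le)
    qed
  qed
  then have "inverse (\<Prod>j\<in>J. pseudohyperbolic_dist z (a j)) \<le> inverse \<rho>"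
    by (simp add: norm_f)
  moreover have "0 < (\<Prod>j\<in>J. pseudohyperbolic_dist z (a j))"
    using z \<eta> by (intro prod_pos) (auto intro: less_le_trans)
  ultimately show ?thesis using \<rho> by simp
qed

text \<open>
  The factor that vanishes at \<open>a n\<close> contributes exactly \<open>\<eta>\<close> on the circle, and the product of the
  others is at least \<open>(\<delta> - \<eta>) / (1 - \<eta> \<delta>)\<close> there by Schwarz-Pick. The hypothesis on \<open>\<rho>\<close> compares
  it with \<open>\<eta>\<close> times this quantity.
\<close>

lemma finite_blaschke_product_ge_on_circle:
  assumes J: "finite J" "\<And>j. j \<in> J \<Longrightarrow> cmod (a j) < 1" and n: "n \<in> J"
    and sep: "\<delta> \<le> (\<Prod>j\<in>J - {n}. pseudohyperbolic_dist (a j) (a n))"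
    and \<eta>: "0 < \<eta>" "\<eta> < 1" and \<delta>: "\<delta> \<le> 1"
    and const: "\<rho> * (1 - \<eta> * \<delta>) \<le> \<eta> * (\<delta> - \<eta>)"
    and z: "cmod z < 1" "pseudohyperbolic_dist z (a n) = \<eta>"
  shows "\<rho> \<le> (\<Prod>j\<in>J. pseudohyperbolic_dist z (a j))"
proof -
  define g where "g x = (\<Prod>j\<in>J - {n}. blaschke_factor (a j) x)" for x
  have norm_g: "cmod (g x) = (\<Prod>j\<in>J - {n}. pseudohyperbolic_dist x (a j))" for x
    by (simp add: g_def prod_norm[symmetric] norm_blaschke_factor)
  have pos: "0 < 1 - \<eta> * \<delta>"
    using mult_left_mono[of \<delta> 1 \<eta>] \<eta> \<delta> by linarith
  have "\<delta> - \<eta> \<le> (1 - \<eta> * \<delta>) * cmod (g z)"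
  proof (cases "J - {n} = {}")
    case True
    have "0 \<le> (1 - \<delta>) * (1 + \<eta>)" using \<eta> \<delta> by simp
    then have "\<delta> - \<eta> \<le> 1 - \<eta> * \<delta>"
      by (simp add: algebra_simps)
    moreover have "cmod (g z) = 1" unfolding norm_g True by simp
    ultimately show ?thesis by simp
  next
    case False
    then obtain k where k: "k \<in> J - {n}" by blast
    show ?thesis
    proof (rule norm_ge_of_Schwarz_Pick[where g = g and p = "a n"])
      show "g holomorphic_on ball 0 1"
        unfolding g_def[abs_def] using blaschke_factor_holomorphic J(2)
        by (intro holomorphic_on_prod) auto
      show "cmod (g x) < 1" if "cmod x < 1" for x
      proof -
        have "cmod (g x) = pseudohyperbolic_dist x (a k)
                             * (\<Prod>j\<in>J - {n} - {k}. pseudohyperbolic_dist x (a j))"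
          unfolding norm_g using k J(1) by (intro prod.remove) auto
        also have "\<dots> \<le> pseudohyperbolic_dist x (a k) * 1"
          using that J(2) pseudohyperbolic_dist_less_1
          by (intro mult_left_mono prod_le_1) (auto simp: pseudohyperbolic_dist_nonneg less_imp_le)
        also have "\<dots> < 1"
          using that J(2) k pseudohyperbolic_dist_less_1 by auto
        finally show ?thesis .
      qed
      show "\<delta> \<le> cmod (g (a n))"
        using sep by (simp add: norm_g pseudohyperbolic_dist_commute)
    qed (use n J z \<eta> in auto)
  qed
  then have "\<eta> * (\<delta> - \<eta>) \<le> \<eta> * ((1 - \<eta> * \<delta>) * cmod (g z))"
    using \<eta> by (intro mult_left_mono) auto
  then have "\<rho> * (1 - \<eta> * \<delta>) \<le> (\<eta> * cmod (g z)) * (1 - \<eta> * \<delta>)"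
    using const by (simp add: mult_ac)
  then have "\<rho> \<le> \<eta> * cmod (g z)" using pos by simp
  also have "\<dots> = (\<Prod>j\<in>J. pseudohyperbolic_dist z (a j))"
    unfolding norm_g using z prod.remove[OF J(1) n, of "\<lambda>j. pseudohyperbolic_dist z (a j)"] by simp
  finally show ?thesis .
qed

lemma compact_in_unit_ball_norm_bound:
  fixes K :: "complex set"
  assumes "compact K" "K \<subseteq> ball 0 1"
  obtains s where "0 \<le> s" "s < 1" "K \<subseteq> cball 0 s"
proof (cases "K = {}")
  case False
  then obtain x where "x \<in> K" "\<And>y. y \<in> K \<Longrightarrow> cmod y \<le> cmod x"
    using continuous_attains_sup[OF assms(1) False, of cmod] by (auto intro: continuous_intros)
  then show ?thesis using assms by (intro that[of "cmod x"]) auto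
qed (auto intro: that[of 0])

lemma finite_blaschke_product_ge_near_circle:
  assumes J: "finite J" "\<And>j. j \<in> J \<Longrightarrow> cmod (a j) < 1" and \<rho>: "\<rho> < 1"
  obtains s where "0 \<le> s" "s < 1"
    "\<And>z. s < cmod z \<Longrightarrow> cmod z < 1 \<Longrightarrow> \<rho> \<le> (\<Prod>j\<in>J. pseudohyperbolic_dist z (a j))"
proof -
  define K where "K = {z \<in> cball 0 1. (\<Prod>j\<in>J. pseudohyperbolic_dist z (a j)) \<le> \<rho>}"
  have "closed K" unfolding K_def
    by (intro continuous_on_closed_Collect_le continuous_on_prod
          pseudohyperbolic_dist_continuous J continuous_on_const closed_cball)
  moreover have "bounded K" by (rule bounded_subset[of "cball 0 1"]) (auto simp: K_def)
  ultimately have "compact K" by (simp add: compact_eq_bounded_closed)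
  moreover have "cmod z < 1" if "z \<in> K" for z
  proof (rule ccontr)
    assume "\<not> cmod z < 1"
    then have "cmod z = 1" using that by (simp add: K_def)
    then have "(\<Prod>j\<in>J. pseudohyperbolic_dist z (a j)) = 1"
      using J by (simp add: pseudohyperbolic_dist_eq_1)
    then show False using that \<rho> by (simp add: K_def)
  qed
  then have "K \<subseteq> ball 0 1" by auto
  ultimately obtain s where s: "0 \<le> s" "s < 1" "K \<subseteq> cball 0 s"
    using compact_in_unit_ball_norm_bound by blast
  show ?thesis
  proof (rule that[OF s(1,2)])
    fix z assume "s < cmod z" "cmod z < 1"
    then show "\<rho> \<le> (\<Prod>j\<in>J. pseudohyperbolic_dist z (a j))"
      using s(3) by (cases "z \<in> K") (force, simp add: K_def)
  qed
qed

section \<open>Infinite Blaschke products\<close>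

text \<open>
  With \<open>e = \<bar>a\<bar> / a\<close> one has \<open>1 - b z = (1 - \<bar>a\<bar>) (1 + e z) / (1 - cnj a z)\<close> for the factor \<open>b\<close>. The
  bound is uniform on \<open>cball 0 R\<close> and summable along a Blaschke sequence, which is what makes the
  product converge locally uniformly.
\<close>

lemma norm_blaschke_factor_minus_1_le:
  assumes "cmod a < 1" "cmod z \<le> R" "R < 1"
  shows "cmod (blaschke_factor a z - 1) \<le> (1 - cmod a) * (2 / (1 - R))"
proof -
  have R: "0 \<le> R" using assms(2) norm_ge_zero order_trans by blast
  show ?thesis
  proof (cases "a = 0")
    \<comment> \<open>the normalising constant \<open>e\<close> is not available, but the factor is within 2 of 1\<close>
    case True
    have "cmod (z - 1) \<le> 2"
      using norm_triangle_ineq4[of z 1] assms by simp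
    also have "2 \<le> 2 / (1 - R)" using assms R by (simp add: field_simps)
    finally show ?thesis using True by (simp add: blaschke_factor_def)
  next
    case False
    define e where "e = of_real (cmod a) / a"
    have e: "cmod e = 1" "e * a = of_real (cmod a)" using False by (auto simp: e_def norm_divide)
    have cnj: "cnj a = of_real (cmod a) * e"
    proof -
      have "a * cnj a = a * (of_real (cmod a) * e)"
        using complex_norm_square[of a] False by (simp add: e_def power2_eq_square)
      then show ?thesis using False by simp
    qed
    have nz: "1 - cnj a * z \<noteq> 0" using one_minus_cnj_mult_nonzero[of a z] assms by simp
    have "blaschke_factor a z - 1 = (e * (a - z) - (1 - cnj a * z)) / (1 - cnj a * z)"
      using nz False by (simp add: blaschke_factor_def e_def[symmetric] diff_divide_distrib[of _ "1 - _"])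
    also have "e * (a - z) - (1 - cnj a * z) = - (of_real (1 - cmod a) * (1 + e * z))"
      using e(2) by (simp add: cnj algebra_simps)
    finally have "cmod (blaschke_factor a z - 1)
        = (1 - cmod a) * (cmod (1 + e * z) / cmod (1 - cnj a * z))"
      using assms by (simp only: norm_divide norm_minus_cancel norm_mult norm_of_real) simp
    also have "\<dots> \<le> (1 - cmod a) * (2 / (1 - R))"
    proof (intro mult_left_mono frac_le)
      show "cmod (1 + e * z) \<le> 2"
        using norm_triangle_ineq[of 1 "e * z"] e assms by (simp add: norm_mult)
      have "cmod a * cmod z \<le> 1 * R" using assms by (intro mult_mono) auto
      then show "1 - R \<le> cmod (1 - cnj a * z)"
        using norm_triangle_ineq2[of 1 "cnj a * z"] by (simp add: norm_mult)
    qed (use assms in auto)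
    finally show ?thesis .
  qed
qed

context
  fixes a :: "nat \<Rightarrow> complex"
  assumes a: "blaschke_sequence a"
begin

lemma blaschke_sequence_norm_less_1: "cmod (a n) < 1"
  using a by (simp add: blaschke_sequence_def)

lemma blaschke_sequence_tendsto: "(\<lambda>n. cmod (a n)) \<longlonglongrightarrow> 1"
proof -
  have "(\<lambda>n. 1 - cmod (a n)) \<longlonglongrightarrow> 0"
    using a by (auto simp: blaschke_sequence_def intro: summable_LIMSEQ_zero)
  then have "(\<lambda>n. 1 - (1 - cmod (a n))) \<longlonglongrightarrow> 1 - 0" by (intro tendsto_intros)
  then show ?thesis by simp
qed

lemma summable_blaschke_bound: "summable (\<lambda>n. (1 - cmod (a n)) * c)"
  using a by (simp add: blaschke_sequence_def summable_mult2)

lemma convergent_blaschke_product: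
  assumes "cmod z < 1"
  shows "convergent_prod (\<lambda>n. blaschke_factor (a n) z)"
proof -
  have "summable (\<lambda>n. cmod (blaschke_factor (a n) z - 1))"
    using norm_blaschke_factor_minus_1_le[OF blaschke_sequence_norm_less_1 order_refl assms]
    by (intro summable_comparison_test'[OF summable_blaschke_bound[of "2 / (1 - cmod z)"], of 0])
      simp
  then show ?thesis
    by (intro abs_convergent_prod_imp_convergent_prod summable_imp_abs_convergent_prod)
qed

lemma blaschke_product_tendsto:
  assumes "cmod z < 1"
  shows "(\<lambda>M. \<Prod>n<M. blaschke_factor (a n) z) \<longlonglongrightarrow> (\<Prod>n. blaschke_factor (a n) z)"
  using has_prod_imp_tendsto'[OF convergent_prod_has_prod[OF convergent_blaschke_product[OF assms]]] .

lemma norm_blaschke_product_tendsto: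
  assumes "cmod z < 1"
  shows "(\<lambda>M. \<Prod>n<M. pseudohyperbolic_dist z (a n)) \<longlonglongrightarrow> cmod (\<Prod>n. blaschke_factor (a n) z)"
  using tendsto_norm[OF blaschke_product_tendsto[OF assms]]
  by (simp add: prod_norm[symmetric] norm_blaschke_factor)

lemma blaschke_product_holomorphic:
  "(\<lambda>z. \<Prod>n. blaschke_factor (a n) z) holomorphic_on ball 0 1"
proof (rule holomorphic_uniform_sequence)
  show "(\<lambda>z. \<Prod>n<M. blaschke_factor (a n) z) holomorphic_on ball 0 1" for M
    using blaschke_factor_holomorphic blaschke_sequence_norm_less_1
    by (intro holomorphic_intros) auto
  fix x :: complex assume x: "x \<in> ball 0 1"
  then obtain d where d: "0 < d" "cball x d \<subseteq> ball 0 1"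
    using open_contains_cball open_ball by blast
  obtain R where R: "R < 1" "cball x d \<subseteq> cball 0 R"
    using compact_in_unit_ball_norm_bound[OF compact_cball d(2)] by blast
  have "uniformly_convergent_on (cball x d) (\<lambda>M z. \<Prod>n<M. blaschke_factor (a n) z)"
  proof (rule uniformly_convergent_on_prod')
    show "continuous_on (cball x d) (blaschke_factor (a n))" for n
      using holomorphic_on_imp_continuous_on[OF blaschke_factor_holomorphic]
        blaschke_sequence_norm_less_1 d(2) continuous_on_subset by blast
    show "uniformly_convergent_on (cball x d) (\<lambda>M z. \<Sum>n<M. cmod (blaschke_factor (a n) z - 1))"
    proof (rule Weierstrass_m_test')
      fix n z assume "z \<in> cball x d"
      then have "cmod z \<le> R" using R(2) by auto
      then show "norm (cmod (blaschke_factor (a n) z - 1)) \<le> (1 - cmod (a n)) * (2 / (1 - R))"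
        using norm_blaschke_factor_minus_1_le blaschke_sequence_norm_less_1 R(1) by simp
    qed (rule summable_blaschke_bound)
  qed (rule compact_cball)
  then obtain l where l: "uniform_limit (cball x d) (\<lambda>M z. \<Prod>n<M. blaschke_factor (a n) z) l sequentially"
    by (auto simp: uniformly_convergent_on_def)
  have "l z = (\<Prod>n. blaschke_factor (a n) z)" if "z \<in> cball x d" for z
  proof (rule LIMSEQ_unique)
    show "(\<lambda>M. \<Prod>n<M. blaschke_factor (a n) z) \<longlonglongrightarrow> l z"
      using tendsto_uniform_limitI[OF l that] .
    show "(\<lambda>M. \<Prod>n<M. blaschke_factor (a n) z) \<longlonglongrightarrow> (\<Prod>n. blaschke_factor (a n) z)"
      using that d(2) by (intro blaschke_product_tendsto) auto
  qed
  then have "uniform_limit (cball x d) (\<lambda>M z. \<Prod>n<M. blaschke_factor (a n) z)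
      (\<lambda>z. \<Prod>n. blaschke_factor (a n) z) sequentially"
    using l uniform_limit_cong'[of "cball x d"] by (metis (no_types, lifting))
  then show "\<exists>d>0. cball x d \<subseteq> ball 0 1 \<and>
      uniform_limit (cball x d) (\<lambda>M z. \<Prod>n<M. blaschke_factor (a n) z)
        (\<lambda>z. \<Prod>n. blaschke_factor (a n) z) sequentially"
    using d by blast
qed simp

lemma norm_blaschke_product_less_1:
  assumes "cmod z < 1"
  shows "cmod (\<Prod>n. blaschke_factor (a n) z) < 1"
proof -
  have "(\<Prod>n<Suc M. pseudohyperbolic_dist z (a n)) \<le> pseudohyperbolic_dist z (a 0)" for M
  proof -
    have "(\<Prod>n<Suc M. pseudohyperbolic_dist z (a n))
        = pseudohyperbolic_dist z (a 0) * (\<Prod>n<M. pseudohyperbolic_dist z (a (Suc n)))"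
      by (rule prod.lessThan_Suc_shift)
    also have "\<dots> \<le> pseudohyperbolic_dist z (a 0) * 1"
      using assms blaschke_sequence_norm_less_1 pseudohyperbolic_dist_less_1
      by (intro mult_left_mono prod_le_1) (auto simp: pseudohyperbolic_dist_nonneg less_imp_le)
    finally show ?thesis by simp
  qed
  then have "cmod (\<Prod>n. blaschke_factor (a n) z) \<le> pseudohyperbolic_dist z (a 0)"
    by (intro LIMSEQ_le_const2[OF LIMSEQ_Suc[OF norm_blaschke_product_tendsto[OF assms]]]) auto
  also have "\<dots> < 1"
    using assms blaschke_sequence_norm_less_1 by (intro pseudohyperbolic_dist_less_1) auto
  finally show ?thesis .
qed

text \<open>
  The product vanishes at \<open>a 0\<close>, whereas at any point of the disk off the countable set of zeros it is
  a convergent product of nonzero factors and so does not vanish.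
\<close>

lemma blaschke_product_not_constant:
  "\<not> (\<lambda>z. \<Prod>n. blaschke_factor (a n) z) constant_on ball 0 1"
proof
  assume "(\<lambda>z. \<Prod>n. blaschke_factor (a n) z) constant_on ball 0 1"
  then obtain c where c: "(\<Prod>n. blaschke_factor (a n) z) = c" if "cmod z < 1" for z
    by (auto simp: constant_on_def)
  have "uncountable (ball (0::complex) 1)" by (rule uncountable_ball) simp
  then have "\<not> ball 0 1 \<subseteq> range a"
    using countable_subset[of "ball 0 1" "range a"] by auto
  then obtain z where z: "cmod z < 1" "z \<notin> range a" unfolding subset_iff mem_ball_0 by blast
  have "blaschke_factor (a n) z \<noteq> 0" for n
    using z one_minus_cnj_mult_nonzero[OF blaschke_sequence_norm_less_1, of z n]
    by (auto simp: blaschke_factor_def)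
  then have "c \<noteq> 0"
    using prodinf_nonzero[OF convergent_blaschke_product[OF z(1)]] c[OF z(1)] by auto
  moreover have "c = 0"
  proof (rule LIMSEQ_unique)
    show "(\<lambda>M. \<Prod>n<Suc M. blaschke_factor (a n) (a 0)) \<longlonglongrightarrow> c"
      using LIMSEQ_Suc[OF blaschke_product_tendsto[OF blaschke_sequence_norm_less_1[of 0]]]
        c[OF blaschke_sequence_norm_less_1] by simp
    have "blaschke_factor (a 0) (a 0) = 0" by (simp add: blaschke_factor_def)
    then show "(\<lambda>M. \<Prod>n<Suc M. blaschke_factor (a n) (a 0)) \<longlonglongrightarrow> 0"
      by (simp add: prod.lessThan_Suc_shift del: prod.lessThan_Suc)
  qed
  ultimately show False by simp
qed

section \<open>Thin sequences\<close>

text \<open>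
  All distances are at most 1, so discarding factors only increases the product; the bound on the
  full product passes to every finite set of zeros. The Blaschke condition guarantees that the
  product in the definition of thinness converges, so that its value bounds partial products.
\<close>

lemma thin_sequence_tail_separated:
  assumes thin: "thin_sequence a" and \<delta>: "\<delta> < 1"
  obtains N where "\<And>J n. finite J \<Longrightarrow> n \<in> J \<Longrightarrow> N \<le> n \<Longrightarrow>
     \<delta> \<le> (\<Prod>j\<in>J - {n}. pseudohyperbolic_dist (a j) (a n))"
proof -
  have "eventually (\<lambda>k. \<delta> < (\<Prod>j. if j = k then 1 else pseudohyperbolic_dist (a j) (a k))) sequentially"
    using thin \<delta> unfolding thin_sequence_def by (rule order_tendstoD)
  then obtain N where N: "\<And>k. N \<le> k \<Longrightarrow>
      \<delta> < (\<Prod>j. if j = k then 1 else pseudohyperbolic_dist (a j) (a k))"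
    by (auto simp: eventually_sequentially)
  show ?thesis
  proof (rule that)
    fix J and n :: nat assume J: "finite J" "n \<in> J" and n: "N \<le> n"
    define f where "f j = (if j = n then 1 else pseudohyperbolic_dist (a j) (a n))" for j
    have f01: "0 \<le> f j" "f j \<le> 1" for j
      using pseudohyperbolic_dist_less_1 blaschke_sequence_norm_less_1
      by (auto simp: f_def pseudohyperbolic_dist_nonneg less_imp_le)
    have "norm (f j - 1) \<le> (1 - cmod (a j)) * (2 / (1 - cmod (a n)))" for j
    proof (cases "j = n")
      case False
      have "norm (f j - 1) = \<bar>cmod (blaschke_factor (a j) (a n)) - cmod 1\<bar>"
        using False by (simp add: f_def norm_blaschke_factor pseudohyperbolic_dist_commute)
      also have "\<dots> \<le> cmod (blaschke_factor (a j) (a n) - 1)" by (rule norm_triangle_ineq3)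
      also have "\<dots> \<le> (1 - cmod (a j)) * (2 / (1 - cmod (a n)))"
        using blaschke_sequence_norm_less_1 by (intro norm_blaschke_factor_minus_1_le) auto
      finally show ?thesis .
    qed (use blaschke_sequence_norm_less_1[of n] in \<open>simp add: f_def\<close>)
    then have "summable (\<lambda>j. norm (f j - 1))"
      by (intro summable_comparison_test'[OF summable_blaschke_bound[of "2 / (1 - cmod (a n))"], of 0])
        simp
    then have "convergent_prod f"
      by (intro abs_convergent_prod_imp_convergent_prod summable_imp_abs_convergent_prod)
    then have hp: "f has_prod prodinf f" by (rule convergent_prod_has_prod)
    obtain M where M: "J \<subseteq> {..<M}" using J(1) finite_nat_iff_bounded by blast
    have "\<delta> \<le> prodinf f" using N[OF n] by (simp add: f_def[abs_def])
    also have "\<dots> \<le> prod f {..<M}" by (rule prod_ge_prodinf[OF hp]) (use f01 in auto)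
    also have "\<dots> \<le> prod f (J - {n})"
    proof -
      have "prod f {..<M} = prod f ({..<M} - (J - {n})) * prod f (J - {n})"
        using M by (intro prod.subset_diff) auto
      also have "\<dots> \<le> 1 * prod f (J - {n})"
        using f01 by (intro mult_right_mono prod_le_1 prod_nonneg) auto
      finally show ?thesis by simp
    qed
    also have "\<dots> = (\<Prod>j\<in>J - {n}. pseudohyperbolic_dist (a j) (a n))"
      by (intro prod.cong) (auto simp: f_def)
    finally show "\<delta> \<le> (\<Prod>j\<in>J - {n}. pseudohyperbolic_dist (a j) (a n))" .
  qed
qed

text \<open>
  One factor \<open>\<rho>\<close> comes from the first \<open>N\<close> zeros, by closeness to the unit circle, and the other from
  the zeros \<open>a n\<close> with \<open>n \<ge> N\<close>, by separation. Points on a circle are listed besides points outside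
  all discs because a circle may enter another disc.
\<close>

lemma blaschke_product_ge_off_discs:
  assumes thin: "thin_sequence a" and \<rho>: "0 < \<rho>" "\<rho> < \<eta>" and \<eta>: "\<eta> < 1"
  obtains s N where "0 \<le> s" "s < 1"
    "\<And>z. s < cmod z \<Longrightarrow> cmod z < 1 \<Longrightarrow>
       (\<forall>n\<ge>N. \<eta> \<le> pseudohyperbolic_dist z (a n)) \<or> (\<exists>n\<ge>N. pseudohyperbolic_dist z (a n) = \<eta>) \<Longrightarrow>
       \<rho>\<^sup>2 \<le> cmod (\<Prod>n. blaschke_factor (a n) z)"
proof -
  \<comment> \<open>the solution of \<open>\<rho> (1 - \<eta> \<delta>) = \<eta> (\<delta> - \<eta>)\<close>; it is below 1 exactly because \<open>\<rho> < \<eta> < 1\<close>\<close>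
  define \<delta> where "\<delta> = (\<rho> + \<eta>\<^sup>2) / (\<eta> + \<rho> * \<eta>)"
  have den: "\<eta> + \<rho> * \<eta> > 0" using \<rho> by (intro add_pos_pos mult_pos_pos) auto
  have "0 < (\<eta> - \<rho>) * (1 - \<eta>)" using \<rho> \<eta> by simp
  then have "\<rho> + \<eta>\<^sup>2 < \<eta> + \<rho> * \<eta>" by (simp add: algebra_simps power2_eq_square)
  then have \<delta>: "\<delta> < 1" using den by (simp add: \<delta>_def)
  have "\<delta> * (\<eta> + \<rho> * \<eta>) = \<rho> + \<eta>\<^sup>2" using den by (simp add: \<delta>_def)
  then have const: "\<rho> * (1 - \<eta> * \<delta>) \<le> \<eta> * (\<delta> - \<eta>)"
    by (simp add: algebra_simps power2_eq_square)
  obtain N where N: "\<And>J n. finite J \<Longrightarrow> n \<in> J \<Longrightarrow> N \<le> n \<Longrightarrow>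
     \<delta> \<le> (\<Prod>j\<in>J - {n}. pseudohyperbolic_dist (a j) (a n))"
    using thin_sequence_tail_separated[OF thin \<delta>] by blast
  obtain s where s: "0 \<le> s" "s < 1" "\<And>z. s < cmod z \<Longrightarrow> cmod z < 1 \<Longrightarrow>
      \<rho> \<le> (\<Prod>j<N. pseudohyperbolic_dist z (a j))"
    using finite_blaschke_product_ge_near_circle[of "{..<N}" a \<rho>]
      blaschke_sequence_norm_less_1 \<rho> \<eta> by auto
  have circle: "\<rho> \<le> (\<Prod>j\<in>{N..<M}. pseudohyperbolic_dist z (a j))"
    if "n \<in> {N..<M}" "cmod z < 1" "pseudohyperbolic_dist z (a n) = \<eta>" for n M z
    using that N[of "{N..<M}" n] \<delta> const \<rho> \<eta> blaschke_sequence_norm_less_1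
    by (intro finite_blaschke_product_ge_on_circle[where n = n and \<delta> = \<delta> and \<eta> = \<eta>]) auto
  show ?thesis
  proof (rule that[OF s(1,2)])
    fix z assume z: "s < cmod z" "cmod z < 1"
      and off: "(\<forall>n\<ge>N. \<eta> \<le> pseudohyperbolic_dist z (a n)) \<or>
                (\<exists>n\<ge>N. pseudohyperbolic_dist z (a n) = \<eta>)"
    have "\<exists>M0\<ge>N. \<forall>M\<ge>M0. \<rho> \<le> (\<Prod>j\<in>{N..<M}. pseudohyperbolic_dist z (a j))"
      using off
    proof
      assume out: "\<forall>n\<ge>N. \<eta> \<le> pseudohyperbolic_dist z (a n)"
      have "\<rho> \<le> (\<Prod>j\<in>{N..<M}. pseudohyperbolic_dist z (a j))" for M
      proof (rule finite_blaschke_product_minimum_modulus[where \<eta> = \<eta>])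
        show "\<rho> \<le> (\<Prod>j\<in>{N..<M}. pseudohyperbolic_dist x (a j))"
          if "n \<in> {N..<M}" "cmod x < 1" "pseudohyperbolic_dist x (a n) = \<eta>" for n x
          using circle that by blast
      qed (use \<rho> \<eta> z out blaschke_sequence_norm_less_1 in auto)
      then show ?thesis by blast
    next
      assume "\<exists>n\<ge>N. pseudohyperbolic_dist z (a n) = \<eta>"
      then obtain n where "n \<ge> N" "pseudohyperbolic_dist z (a n) = \<eta>" by blast
      \<comment> \<open>the circle bound needs the zero \<open>a n\<close> to be among the factors, hence \<open>M > n\<close>\<close>
      then show ?thesis using circle[of n _ z] z by (intro exI[of _ "Suc n"]) auto
    qed
    then obtain M0 where M0: "M0 \<ge> N"
      "\<And>M. M \<ge> M0 \<Longrightarrow> \<rho> \<le> (\<Prod>j\<in>{N..<M}. pseudohyperbolic_dist z (a j))" by blast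
    have "\<rho>\<^sup>2 \<le> (\<Prod>j<M. pseudohyperbolic_dist z (a j))" if "M \<ge> M0" for M
    proof -
      have "\<rho>\<^sup>2 \<le> (\<Prod>j<N. pseudohyperbolic_dist z (a j)) * (\<Prod>j\<in>{N..<M}. pseudohyperbolic_dist z (a j))"
        unfolding power2_eq_square using s(3) z M0(2)[OF that] \<rho>
        by (intro mult_mono prod_nonneg) (auto simp: pseudohyperbolic_dist_nonneg)
      also have "\<dots> = (\<Prod>j<M. pseudohyperbolic_dist z (a j))"
        using prod.atLeastLessThan_concat[of 0 N M "\<lambda>j. pseudohyperbolic_dist z (a j)"] M0(1) that
        by (simp add: lessThan_atLeast0)
      finally show ?thesis .
    qed
    then show "\<rho>\<^sup>2 \<le> cmod (\<Prod>n. blaschke_factor (a n) z)"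
      using z(2) by (intro LIMSEQ_le_const[OF norm_blaschke_product_tendsto]) auto
  qed
qed

text \<open>
  Points of \<open>V\<close> of modulus greater than \<open>s\<close> lie in the discs of radius \<open>\<eta>\<close> around the tail zeros and on
  none of the bounding circles. A circle around \<open>a n\<close> with \<open>\<bar>a n\<bar> > \<sigma>\<close> lies entirely in that range,
  so \<open>V\<close> cannot leave such a disc once it meets it. Only finitely many zeros have
  \<open>\<bar>a n\<bar> \<le> \<sigma>\<close>, and if \<open>V\<close> meets no other disc, those finitely many discs and \<open>cball 0 s\<close> contain it.
\<close>

lemma thin_blaschke_sublevel_connected_bounded:
  assumes thin: "thin_sequence a" and r: "0 < r" "r < 1"
    and V: "connected V" "V \<subseteq> ball 0 1" "\<And>z. z \<in> V \<Longrightarrow> cmod (\<Prod>n. blaschke_factor (a n) z) < r"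
  obtains t where "t < 1" "V \<subseteq> cball 0 t"
proof -
  define \<rho> where "\<rho> = (1 + r) / 2"
  define \<eta> where "\<eta> = (1 + \<rho>) / 2"
  have \<rho>: "0 < \<rho>" "\<rho> < \<eta>" and \<eta>: "\<eta> < 1" "0 \<le> \<eta>" using r by (auto simp: \<rho>_def \<eta>_def)
  have "\<rho>\<^sup>2 - r = ((1 - r) / 2)\<^sup>2" by (simp add: \<rho>_def power2_eq_square field_simps)
  then have r\<rho>: "r \<le> \<rho>\<^sup>2" using zero_le_power2[of "(1 - r) / 2"] by linarith
  obtain s N where s: "0 \<le> s" "s < 1" and lower:
    "\<And>z. s < cmod z \<Longrightarrow> cmod z < 1 \<Longrightarrow>
       (\<forall>n\<ge>N. \<eta> \<le> pseudohyperbolic_dist z (a n)) \<or> (\<exists>n\<ge>N. pseudohyperbolic_dist z (a n) = \<eta>) \<Longrightarrow>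
       \<rho>\<^sup>2 \<le> cmod (\<Prod>n. blaschke_factor (a n) z)"
    by (rule blaschke_product_ge_off_discs[OF thin \<rho> \<eta>(1)]) (rule that)
  \<comment> \<open>a point of modulus at most \<open>s\<close> has distance more than \<open>\<eta>\<close> from any zero of modulus above \<open>\<sigma>\<close>;
    \<open>t n\<close> is the largest modulus on the closed disc of radius \<open>\<eta>\<close> around \<open>a n\<close>\<close>
  define \<sigma> where "\<sigma> = (\<eta> + s) / (1 + \<eta> * s)"
  define t where "t n = (\<eta> + cmod (a n)) / (1 + \<eta> * cmod (a n))" for n
  have \<sigma>: "\<sigma> < 1" unfolding \<sigma>_def using \<eta> s by (intro pseudohyperbolic_sum_less_1) auto
  have t: "t n < 1" for n
    unfolding t_def using \<eta> blaschke_sequence_norm_less_1 by (intro pseudohyperbolic_sum_less_1) auto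
  have disc: "cmod z \<le> t n" if "cmod z < 1" "pseudohyperbolic_dist z (a n) < \<eta>" for z n
    unfolding t_def using that \<eta> blaschke_sequence_norm_less_1
    by (intro norm_le_of_pseudohyperbolic_dist_le[where z = "a n"])
       (auto simp: pseudohyperbolic_dist_commute[of "a n"])
  show ?thesis
  proof (cases "\<exists>n\<ge>N. \<sigma> < cmod (a n) \<and> (\<exists>p\<in>V. pseudohyperbolic_dist p (a n) < \<eta>)")
    case True
    then obtain n p where n: "n \<ge> N" "\<sigma> < cmod (a n)" and p: "p \<in> V" "pseudohyperbolic_dist p (a n) < \<eta>"
      by blast
    have avoid: "pseudohyperbolic_dist q (a n) \<noteq> \<eta>" if "q \<in> V" for q
    proof
      assume q: "pseudohyperbolic_dist q (a n) = \<eta>"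
      have q1: "cmod q < 1" using V(2) that by auto
      have "cmod q \<le> s"
      proof (rule ccontr)
        assume "\<not> ?thesis"
        then have "\<rho>\<^sup>2 \<le> cmod (\<Prod>n. blaschke_factor (a n) q)"
          using q q1 n(1) by (intro lower) auto
        then show False using V(3)[OF that] r\<rho> by simp
      qed
      then have "cmod (a n) \<le> \<sigma>"
        unfolding \<sigma>_def using q q1 \<eta> blaschke_sequence_norm_less_1
        by (intro norm_le_of_pseudohyperbolic_dist_le[where z = q]) auto
      then show False using n by simp
    qed
    have "continuous_on V (\<lambda>z. pseudohyperbolic_dist z (a n))"
      using pseudohyperbolic_dist_continuous[OF blaschke_sequence_norm_less_1] V(2)
        ball_subset_cball continuous_on_subset by blast
    then have conn: "connected ((\<lambda>z. pseudohyperbolic_dist z (a n)) ` V)"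
      using V(1) by (rule connected_continuous_image)
    have "pseudohyperbolic_dist q (a n) < \<eta>" if "q \<in> V" for q
    proof (rule ccontr)
      assume "\<not> ?thesis"
      then have "\<eta> \<in> (\<lambda>z. pseudohyperbolic_dist z (a n)) ` V"
        using connectedD_interval[OF conn, of "pseudohyperbolic_dist p (a n)"
            "pseudohyperbolic_dist q (a n)" \<eta>] p that by simp
      then show False using avoid by auto
    qed
    then show ?thesis
      using V(2) disc by (intro that[OF t[of n]]) auto
  next
    case no_far: False
    define F where "F = {n. \<not> \<sigma> < cmod (a n)}"
    have "eventually (\<lambda>n. \<sigma> < cmod (a n)) sequentially"
      using blaschke_sequence_tendsto \<sigma> by (rule order_tendstoD)
    then have F: "finite F"
      unfolding F_def by (simp add: eventually_cofinite flip: cofinite_eq_sequentially)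
    show ?thesis
    proof (rule that[of "Max (insert s (t ` F))"])
      show "Max (insert s (t ` F)) < 1" using F s t by auto
      show "V \<subseteq> cball 0 (Max (insert s (t ` F)))"
      proof
        fix z assume z: "z \<in> V"
        then have z1: "cmod z < 1" using V(2) by auto
        have "\<exists>x\<in>insert s (t ` F). cmod z \<le> x"
        proof (cases "cmod z \<le> s")
          case False
          have "\<not> (\<forall>n\<ge>N. \<eta> \<le> pseudohyperbolic_dist z (a n))"
          proof
            assume "\<forall>n\<ge>N. \<eta> \<le> pseudohyperbolic_dist z (a n)"
            then have "\<rho>\<^sup>2 \<le> cmod (\<Prod>n. blaschke_factor (a n) z)"
              using z1 False by (intro lower) auto
            then show False using V(3)[OF z] r\<rho> by simp
          qed
          then obtain n where n: "n \<ge> N" "pseudohyperbolic_dist z (a n) < \<eta>"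
            by (auto simp: not_le)
          then have "n \<in> F" using no_far z by (auto simp: F_def)
          with n show ?thesis using disc z1 by blast
        qed simp
        then show "z \<in> cball 0 (Max (insert s (t ` F)))"
          using F by (auto simp: Max_ge_iff)
      qed
    qed
  qed
qed

end

section \<open>Relatively compact components of preimages\<close>

text \<open>
  The component \<open>V\<close> is the trace of a closed set \<open>T\<close> on the preimage of \<open>U\<close>. For \<open>K\<close> inside \<open>U\<close> the set
  \<open>V \<inter> f -` K\<close> is therefore the trace of \<open>T\<close> on the part of \<open>f -` K\<close> in \<open>cball 0 t\<close>, which is
  closed since \<open>f\<close> is continuous on this compact disk. For surjectivity, properness over small closed balls
  shows that \<open>f ` V\<close> is closed in \<open>U\<close>.
\<close>

lemma proper_surjective_on_relatively_compact_component:
  assumes f: "f holomorphic_on ball 0 1" "\<not> f constant_on ball 0 1"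
    and U: "open U" "connected U"
    and V: "V \<in> components (ball 0 1 \<inter> f -` U)" "V \<subseteq> cball 0 t" "t < 1"
  shows "K \<subseteq> U \<Longrightarrow> compact K \<Longrightarrow> compact (V \<inter> f -` K)" "f ` V = U"
proof -
  have cont: "continuous_on (ball 0 1) f" using f(1) by (rule holomorphic_on_imp_continuous_on)
  have cont_t: "continuous_on (cball 0 t) f"
    using cont by (rule continuous_on_subset) (use V(3) in auto)
  have VS: "V \<subseteq> ball 0 1 \<inter> f -` U" "V \<noteq> {}"
    using V(1) by (auto dest: in_components_subset in_components_nonempty)
  obtain T where T: "closed T" "V = (ball 0 1 \<inter> f -` U) \<inter> T"
    using closedin_component[OF V(1)] by (auto simp: closedin_closed)
  show proper: "compact (V \<inter> f -` K)" if "K \<subseteq> U" "compact K" for K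
  proof -
    have "V \<inter> f -` K = T \<inter> (cball 0 t \<inter> f -` K)"
      using T(2) V(2,3) that(1) by fastforce
    moreover have "closed (cball 0 t \<inter> f -` K)"
      using cont_t that(2) by (intro continuous_closed_preimage) (auto intro: compact_imp_closed)
    ultimately have "closed (V \<inter> f -` K)" using T(1) by auto
    moreover have "bounded (V \<inter> f -` K)" using V(2) by (meson bounded_cball bounded_subset inf.coboundedI1)
    ultimately show ?thesis by (simp add: compact_eq_bounded_closed)
  qed
  have "open (ball 0 1 \<inter> f -` U)"
    using cont U(1) by (intro continuous_open_preimage) auto
  then have "open V" using V(1) by (rule open_components)
  then have "open (f ` V)"
    using VS f by (intro open_mapping_thm[of f "ball 0 1"]) auto
  moreover have "open (U - f ` V)"
  proof (rule openI)
    fix w assume w: "w \<in> U - f ` V"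
    then obtain e where e: "e > 0" "cball w e \<subseteq> U" using U(1) open_contains_cball by blast
    define C where "C = f ` (V \<inter> f -` cball w e)"
    have "continuous_on (V \<inter> f -` cball w e) f"
      using cont by (rule continuous_on_subset) (use VS in auto)
    then have "compact C"
      unfolding C_def using proper[OF e(2) compact_cball] by (rule compact_continuous_image)
    then have "open (ball w e - C)" by (intro open_Diff) (auto intro: compact_imp_closed)
    moreover have "w \<in> ball w e - C" using w e by (auto simp: C_def)
    moreover have "ball w e - C \<subseteq> U - f ` V" using e(2) by (auto simp: C_def)
    ultimately show "\<exists>e>0. ball w e \<subseteq> U - f ` V"
      by (meson open_contains_ball order_trans)
  qed
  ultimately have "f ` V \<inter> U = {} \<or> (U - f ` V) \<inter> U = {}"
    using U(2) by (intro connectedD) auto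
  then show "f ` V = U" using VS by auto
qed

theorem proposition2p3:
  fixes B :: "complex \<Rightarrow> complex"
  assumes "thin_blaschke_product B"
  shows "branched_covering_map B (ball 0 1)"
proof -
  obtain a u where a: "blaschke_sequence a" and thin: "thin_sequence a" and u: "cmod u = 1"
    and B: "\<And>z. z \<in> ball 0 1 \<Longrightarrow> B z = u * (\<Prod>n. blaschke_factor (a n) z)"
    using assms
    unfolding thin_blaschke_product_def infinite_blaschke_product_with_zeros_def by blast
  have norm_B: "cmod (B z) = cmod (\<Prod>n. blaschke_factor (a n) z)" if "z \<in> ball 0 1" for z
    using B[OF that] u by (simp add: norm_mult)
  have "(\<lambda>z. u * (\<Prod>n. blaschke_factor (a n) z)) holomorphic_on ball 0 1"
    by (intro holomorphic_on_mult holomorphic_on_const blaschke_product_holomorphic[OF a])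
  then have hol: "B holomorphic_on ball 0 1"
    using B by (subst holomorphic_cong[OF refl]) auto
  have nonconst: "\<not> B constant_on ball 0 1"
  proof
    assume "B constant_on ball 0 1"
    then obtain c where "\<And>z. z \<in> ball 0 1 \<Longrightarrow> B z = c" by (auto simp: constant_on_def)
    then have "\<And>z. z \<in> ball 0 1 \<Longrightarrow> (\<Prod>n. blaschke_factor (a n) z) = c / u"
      using B u by (metis nonzero_mult_div_cancel_left norm_zero zero_neq_one)
    then show False
      using blaschke_product_not_constant[OF a] unfolding constant_on_def by blast
  qed
  show ?thesis
    unfolding branched_covering_map_def
  proof (intro conjI ballI)
    show "B holomorphic_on ball 0 1" by (rule hol)
    show "B ` ball 0 1 \<subseteq> ball 0 1"
      using norm_B norm_blaschke_product_less_1[OF a] by auto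
    fix w :: complex assume "w \<in> ball 0 1"
    then obtain r where r: "cmod w < r" "r < 1" using dense[of "cmod w" 1] by auto
    then have r0: "0 < r" using norm_ge_zero[of w] by linarith
    have "B ` V = ball 0 r \<and> (\<forall>K. K \<subseteq> ball 0 r \<and> compact K \<longrightarrow> compact (V \<inter> B -` K))"
      if V: "V \<in> components (ball 0 1 \<inter> B -` ball 0 r)" for V
    proof -
      have sub: "V \<subseteq> ball 0 1 \<inter> B -` ball 0 r" using V by (rule in_components_subset)
      then have "V \<subseteq> ball 0 1" by blast
      moreover have "cmod (\<Prod>n. blaschke_factor (a n) z) < r" if "z \<in> V" for z
        using that sub norm_B by fastforce
      ultimately obtain t where t: "t < 1" "V \<subseteq> cball 0 t"
        by (rule thin_blaschke_sublevel_connected_bounded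
            [OF a thin r0 r(2) in_components_connected[OF V]])
      show ?thesis
        using proper_surjective_on_relatively_compact_component
          [OF hol nonconst open_ball connected_ball V t(2,1)] by blast
    qed
    then show "\<exists>U. open U \<and> connected U \<and> w \<in> U \<and> U \<subseteq> ball 0 1 \<and>
        (\<forall>V\<in>components (ball 0 1 \<inter> B -` U).
           B ` V = U \<and> (\<forall>K. K \<subseteq> U \<and> compact K \<longrightarrow> compact (V \<inter> B -` K)))"
      using r by (intro exI[of _ "ball 0 r"]) auto
  qed
qed

end
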